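(* Let $T=(Q,q_0,\Omega,S,\Delta,\lambda)$ and $T'=(Q',q'_0,\Omega,S,\Delta',\lambda')$ be accessible fiber-linear graph-respecting transducers over the same visible graph $(S,E)$ and with the same initial visible state, i.e. $\lambda(q_0)=\lambda'(q'_0)$. Assume that every visible state is reachable and admits a realizable non-self departure in both transducers. If $T$ and $T'$ induce the same visible-state transduction, i.e. $\mathrm{Out}_T(w)=\mathrm{Out}_{T'}(w)$ for all $w\in\Omega^*$, then $T$ and $T'$ are isomorphic.
   Context: $S$ is a finite set (visible states), $E\subseteq S\times S$, $\mathrm{Out}(i)=\{j\in S:(i,j)\in E\}$; $\Omega$ is a finite input alphabet. A graph-respecting (labeled) transducer for $(S,E)$ is a deterministic transducer $T=(Q,q_0,\Omega,S,\Delta,\lambda)$ with $\Delta:Q\times\Omega\to Q$, $Q$ finite, $\lambda:Q\to S$ surjective, and $\lambda(\Delta(q,u))\in\mathrm{Out}(\lambda(q))$ for all $q\in Q,u\in\Omega$. On reading $w=u_1\cdots u_n$ it visits $q_0,q_1,\dots,q_n$ with $q_t=\Delta(q_{t-1},u_t)$ and emits $\mathrm{Out}_T(w)=\lambda(q_1)\cdots\lambda(q_n)$. It is accessible if every control state is reached from $q_0$ by some input word. A visible state $i$ is reachable if some state with label $i$ is reached from $q_0$. A state $q$ is forced-hold if there is $q'\in Q$ with $\lambda(q')=\lambda(q)$ and $\Delta(q,u)=q'$ for every $u\in\Omega$; then $\mathrm{hsucc}(q):=q'$. Otherwise $q$ is a decision state. For $i\in S$ let $\mathrm{Fib}(i)=\lambda^{-1}(i)$;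 the fiber hold graph $H_i$ has vertex set $\mathrm{Fib}(i)$ and an edge $q\to\mathrm{hsucc}(q)$ for each forced-hold $q\in\mathrm{Fib}(i)$. $T$ is fiber-linear if for every $i\in S$: (1) $H_i$ is a directed simple path on the whole of $\mathrm{Fib}(i)$ ending at a unique terminal vertex $p_i$; equivalently, $p_i$ is the unique decision state in $\mathrm{Fib}(i)$, all other states of $\mathrm{Fib}(i)$ are forced-hold, and iterating $\mathrm{hsucc}$ walks through the fiber in a single linear chain until $p_i$; (2) (reset-on-decision) writing $t_i$ for the initial vertex of the path $H_i$ (so $t_i=p_i$ if $|\mathrm{Fib}(i)|=1$), for every $u\in\Omega$, if $\lambda(\Delta(p_i,u))=j$ then $\Delta(p_i,u)=t_j$. A visible state $i$ admits a realizable non-self departure in a fiber-linear $T$ if there is $u\in\Omega$ with $\lambda(\Delta(p_i,u))\ne i$. Isomorphism of such transducers: a bijection $\Phi:Q\to Q'$ with $\Phi(\Delta(q,u))=\Delta'(\Phi(q),u)$ and $\lambda'(\Phi(q))=\lambda(q)$ for all $q\in Q,u\in\Omega$. *)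

theory Defs
  imports "Graph_Theory.Graph_Theory"
begin

text \<open>
  A transducer is the tuple (Q, q0, \<open>\<Omega>\<close>, S, \<open>\<Delta>\<close>, \<open>\<lambda>\<close>). The functions \<open>trans\<close> and \<open>lab\<close> are total
  HOL functions; their values outside the carriers are never referred to.
\<close>

record ('q, 'u, 's) transducer =
  states :: "'q set"
  init :: 'q
  inputs :: "'u set"
  visible :: "'s set"
  trans :: "'q \<Rightarrow> 'u \<Rightarrow> 'q"
  lab :: "'q \<Rightarrow> 's"

definition Out_nbrs :: "'s set \<Rightarrow> ('s \<times> 's) set \<Rightarrow> 's \<Rightarrow> 's set" where
  "Out_nbrs S E i = {j \<in> S. (i, j) \<in> E}"

definition graph_respecting ::
  "'s set \<Rightarrow> ('s \<times> 's) set \<Rightarrow> 'u set \<Rightarrow> ('q, 'u, 's) transducer \<Rightarrow> bool" where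
  "graph_respecting S E \<Omega> T \<longleftrightarrow>
     inputs T = \<Omega> \<and> visible T = S \<and>
     finite (states T) \<and> init T \<in> states T \<and>
     (\<forall>q\<in>states T. \<forall>u\<in>\<Omega>. trans T q u \<in> states T) \<and>
     lab T ` states T = S \<and>
     (\<forall>q\<in>states T. \<forall>u\<in>\<Omega>. lab T (trans T q u) \<in> Out_nbrs S E (lab T q))"

subsection \<open>Runs\<close>

text \<open>\<open>run_from T q [u\<^sub>1, \<dots>, u\<^sub>n]\<close> is the list of states visited \<^emph>\<open>after\<close> the start state \<open>q\<close>.\<close>

primrec run_from :: "('q, 'u, 's) transducer \<Rightarrow> 'q \<Rightarrow> 'u list \<Rightarrow> 'q list" where
  "run_from T q [] = []"
| "run_from T q (u # w) = trans T q u # run_from T (trans T q u) w"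

definition emitted :: "('q, 'u, 's) transducer \<Rightarrow> 'u list \<Rightarrow> 's list" where
  "emitted T w = map (lab T) (run_from T (init T) w)"

definition reached_by_word :: "('q, 'u, 's) transducer \<Rightarrow> 'q \<Rightarrow> bool" where
  "reached_by_word T q \<longleftrightarrow> (\<exists>w\<in>lists (inputs T). last (init T # run_from T (init T) w) = q)"

definition accessible :: "('q, 'u, 's) transducer \<Rightarrow> bool" where
  "accessible T \<longleftrightarrow> (\<forall>q\<in>states T. reached_by_word T q)"

definition visibly_reachable :: "('q, 'u, 's) transducer \<Rightarrow> 's \<Rightarrow> bool" where
  "visibly_reachable T i \<longleftrightarrow> (\<exists>q\<in>states T. lab T q = i \<and> reached_by_word T q)"

subsection \<open>Forced holds and fiber-linearity\<close>

definition holds_to :: "('q, 'u, 's) transducer \<Rightarrow> 'q \<Rightarrow> 'q \<Rightarrow> bool" where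
  "holds_to T q q' \<longleftrightarrow>
     q' \<in> states T \<and> lab T q' = lab T q \<and> (\<forall>u\<in>inputs T. trans T q u = q')"

definition forced_hold :: "('q, 'u, 's) transducer \<Rightarrow> 'q \<Rightarrow> bool" where
  "forced_hold T q \<longleftrightarrow> (\<exists>q'. holds_to T q q')"

abbreviation decision_state :: "('q, 'u, 's) transducer \<Rightarrow> 'q \<Rightarrow> bool" where
  "decision_state T q \<equiv> \<not> forced_hold T q"

definition hsucc :: "('q, 'u, 's) transducer \<Rightarrow> 'q \<Rightarrow> 'q" where
  "hsucc T q = (THE q'. holds_to T q q')"

definition Fib :: "('q, 'u, 's) transducer \<Rightarrow> 's \<Rightarrow> 'q set" where
  "Fib T i = {q \<in> states T. lab T q = i}"

definition hold_graph :: "('q, 'u, 's) transducer \<Rightarrow> 's \<Rightarrow> 'q pair_pre_digraph" where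
  "hold_graph T i =
     \<lparr>pverts = Fib T i, parcs = {(q, hsucc T q) | q. q \<in> Fib T i \<and> forced_hold T q}\<rparr>"

text \<open>The whole digraph \<open>G\<close> is a directed simple path from \<open>t\<close> to \<open>p\<close>: some simple path of \<open>G\<close>
  uses all vertices and all arcs. A single vertex without arcs qualifies, with \<open>t = p\<close>.\<close>

definition is_directed_path :: "'a pair_pre_digraph \<Rightarrow> 'a \<Rightarrow> 'a \<Rightarrow> bool" where
  "is_directed_path G t p \<longleftrightarrow>
     (\<exists>es. pre_digraph.apath (with_proj G) t es p \<and>
           set (pre_digraph.awalk_verts (with_proj G) t es) = pverts G \<and>
           set es = parcs G)"

lemma is_directed_path_ends:
  assumes "is_directed_path G t p" and x: "x \<in> pverts G"
  shows "(\<exists>w. (w, x) \<in> parcs G) \<longleftrightarrow> x \<noteq> t"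
    and "(\<exists>w. (x, w) \<in> parcs G) \<longleftrightarrow> x \<noteq> p"
proof -
  interpret pair_pre_digraph G .
  obtain es where ap: "apath t es p" and vs: "set (awalk_verts t es) = pverts G"
    and es: "set es = parcs G"
    using assms(1) unfolding is_directed_path_def by auto
  have cas: "cas t es p" and dist: "distinct (awalk_verts t es)"
    using ap unfolding apath_def awalk_def by auto
  have "awalk_verts t es = t # map snd es"
    using awalk_verts_conv'[OF cas] cas by (cases es) auto
  then have fwd: "set (awalk_verts t es) = insert t (snd ` set es)" "t \<notin> snd ` set es"
    using dist by (auto simp flip: set_map)
  have "es \<noteq> [] \<Longrightarrow> snd (last es) = p"
    using cas unfolding cas_with_proj_eq by (induct es arbitrary: t) auto
  moreover have "es = [] \<Longrightarrow> t = p"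
    using cas by auto
  ultimately have "awalk_verts t es = map fst es @ [p]"
    by (subst awalk_verts_conv) auto
  then have bwd: "set (awalk_verts t es) = insert p (fst ` set es)" "p \<notin> fst ` set es"
    using dist by (auto simp flip: set_map)
  show "(\<exists>w. (w, x) \<in> parcs G) \<longleftrightarrow> x \<noteq> t"
    using fwd x vs es by (metis image_iff insert_iff prod.collapse snd_conv)
  show "(\<exists>w. (x, w) \<in> parcs G) \<longleftrightarrow> x \<noteq> p"
    using bwd x vs es by (metis image_iff insert_iff prod.collapse fst_conv)
qed

lemma is_directed_path_in_verts:
  assumes "is_directed_path G t p"
  shows "t \<in> pverts G" "p \<in> pverts G"
proof -
  interpret pair_pre_digraph G .
  obtain es where ap: "apath t es p" and vs: "set (awalk_verts t es) = pverts G"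
    using assms unfolding is_directed_path_def by auto
  show "t \<in> pverts G" using ap unfolding apath_def awalk_def by auto
  have "cas t es p" using ap unfolding apath_def awalk_def by auto
  then have "p \<in> set (awalk_verts t es)"
    unfolding cas_with_proj_eq awalk_verts_with_proj_eq by (induct es arbitrary: t) auto
  then show "p \<in> pverts G" using vs by simp
qed

lemma is_directed_path_unique:
  assumes "is_directed_path G t p" "is_directed_path G t' p'"
  shows "t' = t" "p' = p"
proof -
  note V = is_directed_path_in_verts[OF assms(1)]
  show "t' = t"
    using is_directed_path_ends(1)[OF assms(1) V(1)] is_directed_path_ends(1)[OF assms(2) V(1)] by simp
  show "p' = p"
    using is_directed_path_ends(2)[OF assms(1) V(2)] is_directed_path_ends(2)[OF assms(2) V(2)] by simp
qed

text \<open>\<open>t\<^sub>i\<close> and \<open>p\<^sub>i\<close>; meaningful only if \<open>hold_graph T i\<close> is a directed path.\<close>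

definition fiber_init :: "('q, 'u, 's) transducer \<Rightarrow> 's \<Rightarrow> 'q" where
  "fiber_init T i = (THE t. \<exists>p. is_directed_path (hold_graph T i) t p)"

definition fiber_term :: "('q, 'u, 's) transducer \<Rightarrow> 's \<Rightarrow> 'q" where
  "fiber_term T i = (THE p. \<exists>t. is_directed_path (hold_graph T i) t p)"

definition fiber_linear :: "('q, 'u, 's) transducer \<Rightarrow> bool" where
  "fiber_linear T \<longleftrightarrow>
     (\<forall>i\<in>visible T.
        (\<exists>t p. is_directed_path (hold_graph T i) t p) \<and>
        (\<forall>u\<in>inputs T. \<forall>j\<in>visible T.
           lab T (trans T (fiber_term T i) u) = j \<longrightarrow>
           trans T (fiber_term T i) u = fiber_init T j))"

lemma fiber_ends_eq:
  assumes "is_directed_path (hold_graph T i) t p"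
  shows "fiber_init T i = t" "fiber_term T i = p"
proof -
  show "fiber_init T i = t"
    unfolding fiber_init_def
    by (rule the_equality) (use assms in \<open>auto intro: is_directed_path_unique(1)[OF assms]\<close>)
  show "fiber_term T i = p"
    unfolding fiber_term_def
    by (rule the_equality) (use assms in \<open>auto intro: is_directed_path_unique(2)[OF assms]\<close>)
qed

text \<open>The terminal vertex of the path is the unique decision state of the fiber.\<close>

lemma decision_state_iff_fiber_term:
  assumes "is_directed_path (hold_graph T i) t p" "q \<in> Fib T i"
  shows "decision_state T q \<longleftrightarrow> q = fiber_term T i"
proof -
  have "q \<in> pverts (hold_graph T i)"
    using assms(2) by (simp add: hold_graph_def)
  from is_directed_path_ends(2)[OF assms(1) this] show ?thesis
    using assms(2) unfolding fiber_ends_eq[OF assms(1)] by (auto simp: hold_graph_def)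
qed

definition nonself_departure :: "('q, 'u, 's) transducer \<Rightarrow> 's \<Rightarrow> bool" where
  "nonself_departure T i \<longleftrightarrow> (\<exists>u\<in>inputs T. lab T (trans T (fiber_term T i) u) \<noteq> i)"

subsection \<open>Isomorphism\<close>

definition isomorphic :: "('q, 'u, 's) transducer \<Rightarrow> ('r, 'u, 's) transducer \<Rightarrow> bool" where
  "isomorphic T T' \<longleftrightarrow>
     (\<exists>\<Phi>. bij_betw \<Phi> (states T) (states T') \<and>
          (\<forall>q\<in>states T. \<forall>u\<in>inputs T. \<Phi> (trans T q u) = trans T' (\<Phi> q) u) \<and>
          (\<forall>q\<in>states T. lab T' (\<Phi> q) = lab T q))"

end

theory Submission
  imports Defs
begin

text \<open>
  Number the states of a fiber along its hold path. The label stays constant while the path is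
  walked, and the terminal state has an input that changes it; so two states of a fiber at different
  positions are told apart by a word that brings the later one to the terminal state and then
  departs, and \<open>T\<close> is a reduced machine. Two accessible reduced machines with the same
  visible behavior are isomorphic: match the states reached by the same word.
\<close>

abbreviation state_after :: "('q, 'u, 's) transducer \<Rightarrow> 'q \<Rightarrow> 'u list \<Rightarrow> 'q" where
  "state_after T \<equiv> foldl (trans T)"

lemma last_run_from: "last (q # run_from T q w) = state_after T q w"
  by (induction w arbitrary: q) auto

text \<open>\<open>emitted\<close> starts only after the first transition, so the initial label is
  put in front. The list is then nonempty for the empty word too, and \<open>last\<close> is
  meaningful.\<close>

lemma last_emitted: "last (lab T (init T) # emitted T w) = lab T (state_after T (init T) w)"
proof -
  have "lab T (init T) # emitted T w = map (lab T) (init T # run_from T (init T) w)"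
    by (simp add: emitted_def)
  then show ?thesis
    by (metis last_map last_run_from list.distinct(1))
qed

lemma state_after_closed:
  assumes "graph_respecting S E \<Omega> T" "q \<in> states T" "w \<in> lists \<Omega>"
  shows "state_after T q w \<in> states T"
  using assms(3,2)
proof (induction w arbitrary: q)
  case (Cons u w)
  then show ?case using assms(1) by (auto simp: graph_respecting_def)
qed simp

lemma accessibleE:
  assumes "accessible T" "q \<in> states T"
  obtains w where "w \<in> lists (inputs T)" "q = state_after T (init T) w"
  using assms unfolding accessible_def reached_by_word_def last_run_from by metis

text \<open>Moore-style distinguishability: the empty word is among the tests, so indistinguishable
  states automatically lie in one fiber.\<close>

definition reduced :: "('q, 'u, 's) transducer \<Rightarrow> bool" where
  "reduced T \<longleftrightarrow>
     (\<forall>q\<in>states T. \<forall>r\<in>states T.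
        (\<forall>w\<in>lists (inputs T). lab T (state_after T q w) = lab T (state_after T r w)) \<longrightarrow> q = r)"

text \<open>Any single input pins down the target of a hold. With no inputs, every state of the
  fiber would satisfy \<open>holds_to\<close>, and the description in \<open>hsucc\<close> could be
  ambiguous.\<close>

lemma hsucc_eq:
  assumes "holds_to T q q'" "inputs T \<noteq> {}"
  shows "hsucc T q = q'"
  unfolding hsucc_def using assms by (intro the_equality) (auto simp: holds_to_def)

lemma directed_path_vertex_list:
  assumes "is_directed_path G t p"
  obtains vs where "set vs = pverts G" "last vs = p"
    "successively (\<lambda>x y. (x, y) \<in> parcs G) vs"
proof -
  interpret pair_pre_digraph G .
  obtain es where ap: "apath t es p" and vs: "set (awalk_verts t es) = pverts G"
    and es: "set es = parcs G"
    using assms unfolding is_directed_path_def by auto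
  have "cas t es p" using ap unfolding apath_def awalk_def by auto
  \<comment> \<open>Inclusion, unlike equality of the arc sets, is inherited by the tail of
    \<open>es\<close> and so survives the induction.\<close>
  moreover have "set es \<subseteq> parcs G" using es by simp
  ultimately have "last (awalk_verts t es) = p \<and>
      successively (\<lambda>x y. (x, y) \<in> parcs G) (awalk_verts t es)"
    unfolding cas_with_proj_eq awalk_verts_with_proj_eq
  proof (induction es arbitrary: t)
    case (Cons e es)
    then show ?case by (cases e; cases es) auto
  qed simp
  with vs that show thesis by blast
qed

text \<open>A hold ignores the letter it reads, so only the length of \<open>w\<close> counts. The
  bound keeps the run from going past the last vertex.\<close>

lemma state_after_hold_path:
  assumes "successively (holds_to T) vs" "w \<in> lists (inputs T)" "k + length w < length vs"
  shows "state_after T (vs ! k) w = vs ! (k + length w)"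
  using assms(2,3)
proof (induction w arbitrary: k)
  case (Cons u w)
  then have "holds_to T (vs ! k) (vs ! Suc k)"
    using assms(1) by (auto simp: successively_conv_nth)
  then show ?case using Cons by (auto simp: holds_to_def)
qed simp

lemma hold_path_separates:
  assumes path: "successively (holds_to T) vs"
    and u: "u \<in> inputs T" "lab T (trans T (last vs) u) \<noteq> i"
    and labels: "\<And>v. v \<in> set vs \<Longrightarrow> lab T v = i"
    and kl: "k < l" "l < length vs"
  shows "\<exists>w\<in>lists (inputs T). lab T (state_after T (vs ! k) w) \<noteq> lab T (state_after T (vs ! l) w)"
proof -
  \<comment> \<open>The length is exactly the distance from position \<open>l\<close> to the last
    index, so one more \<open>u\<close> is the departure.\<close>
  define w where "w = replicate (length vs - 1 - l) u"
  have w: "w \<in> lists (inputs T)" using u(1) by (auto simp: w_def)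
  have "state_after T (vs ! l) w = last vs"
    using state_after_hold_path[OF path w, of l] kl by (subst last_conv_nth) (auto simp: w_def)
  then have "lab T (state_after T (vs ! l) (w @ [u])) \<noteq> i" using u by simp
  \<comment> \<open>Starting at least one position earlier, the run from \<open>vs ! k\<close> is
    still on the path after the extra letter and keeps the label \<open>i\<close>.\<close>
  moreover have "k + length (w @ [u]) < length vs" using kl by (auto simp: w_def)
  then have "lab T (state_after T (vs ! k) (w @ [u])) = i"
    using state_after_hold_path[OF path, of "w @ [u]" k] w u(1) labels by auto
  ultimately show ?thesis using w u(1) by (intro bexI[of _ "w @ [u]"]) auto
qed

lemma fiber_linear_reduced:
  assumes gr: "graph_respecting S E \<Omega> T" and lin: "fiber_linear T"
    and dep: "\<And>i. i \<in> S \<Longrightarrow> nonself_departure T i"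
  shows "reduced T"
  unfolding reduced_def
proof (intro ballI impI)
  fix q r
  assume q: "q \<in> states T" and r: "r \<in> states T"
    and eq: "\<forall>w\<in>lists (inputs T). lab T (state_after T q w) = lab T (state_after T r w)"
  define i where "i = lab T q"
  have "i \<in> S" using q gr by (auto simp: i_def graph_respecting_def)
  have "lab T r = i" using eq[rule_format, of "[]"] by (simp add: i_def)
  obtain t p where path: "is_directed_path (hold_graph T i) t p"
    using lin gr \<open>i \<in> S\<close> by (auto simp: fiber_linear_def graph_respecting_def)
  \<comment> \<open>This input has two uses: it is the departure that separates positions, and it
    shows that the alphabet is nonempty, as \<open>hsucc_eq\<close> requires.\<close>
  obtain u where u: "u \<in> inputs T" "lab T (trans T p u) \<noteq> i"
    using dep[OF \<open>i \<in> S\<close>] fiber_ends_eq(2)[OF path] by (auto simp: nonself_departure_def)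
  obtain vs where vs: "set vs = Fib T i" "last vs = p"
    "successively (\<lambda>x y. (x, y) \<in> parcs (hold_graph T i)) vs"
    using directed_path_vertex_list[OF path] by (auto simp: hold_graph_def)
  have holds: "successively (holds_to T) vs"
    using vs(3)
  proof (rule successively_mono)
    fix x y assume "(x, y) \<in> parcs (hold_graph T i)"
    then show "holds_to T x y"
      using hsucc_eq u(1) by (fastforce simp: hold_graph_def forced_hold_def)
  qed
  have "q \<in> set vs" "r \<in> set vs"
    using q r \<open>lab T r = i\<close> vs(1) by (auto simp: Fib_def i_def)
  then obtain k l where k: "k < length vs" "q = vs ! k" and l: "l < length vs" "r = vs ! l"
    by (metis in_set_conv_nth)
  have labels: "\<And>v. v \<in> set vs \<Longrightarrow> lab T v = i" using vs(1) by (simp add: Fib_def)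
  note sep = hold_path_separates[OF holds u(1) u(2)[folded vs(2)] labels]
  show "q = r"
    using sep[of k l] sep[of l k] k l eq by (metis linorder_neqE_nat)
qed

text \<open>If two words merge in \<open>T'\<close>, all their common extensions get equal labels
  there, hence also in \<open>T\<close>, where reducedness merges them. Only \<open>T\<close> has to
  be reduced, so exchanging the machines gives the converse.\<close>

lemma reduced_state_after_eq:
  assumes gr: "graph_respecting S E \<Omega> T" and red: "reduced T"
    and same: "\<And>w. w \<in> lists \<Omega> \<Longrightarrow>
      lab T (state_after T (init T) w) = lab T' (state_after T' (init T') w)"
    and v: "v \<in> lists \<Omega>" and w: "w \<in> lists \<Omega>"
    and eq: "state_after T' (init T') v = state_after T' (init T') w"
  shows "state_after T (init T) v = state_after T (init T) w"
proof -
  have "init T \<in> states T" and inp: "inputs T = \<Omega>"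
    using gr by (auto simp: graph_respecting_def)
  then have "state_after T (init T) v \<in> states T" "state_after T (init T) w \<in> states T"
    using state_after_closed[OF gr] v w by auto
  moreover have "lab T (state_after T (state_after T (init T) v) x)
      = lab T (state_after T (state_after T (init T) w) x)" if "x \<in> lists \<Omega>" for x
    using same[of "v @ x"] same[of "w @ x"] v w that eq by simp
  ultimately show ?thesis using red inp unfolding reduced_def by blast
qed

lemma reduced_isomorphic:
  assumes gr: "graph_respecting S E \<Omega> T" and gr': "graph_respecting S E \<Omega> T'"
    and acc: "accessible T" and acc': "accessible T'"
    and red: "reduced T" and red': "reduced T'"
    and same: "\<And>w. w \<in> lists \<Omega> \<Longrightarrow>
      lab T (state_after T (init T) w) = lab T' (state_after T' (init T') w)"
  shows "isomorphic T T'"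
proof -
  let ?f = "state_after T (init T)" and ?f' = "state_after T' (init T')"
  have inp: "inputs T = \<Omega>" "inputs T' = \<Omega>"
    using gr gr' by (auto simp: graph_respecting_def)
  have closed: "?f w \<in> states T" "?f' w \<in> states T'" if "w \<in> lists \<Omega>" for w
    using that gr gr' by (auto intro!: state_after_closed simp: graph_respecting_def)
  have fwd: "?f' v = ?f' w" if "v \<in> lists \<Omega>" "w \<in> lists \<Omega>" "?f v = ?f w" for v w
    using reduced_state_after_eq[OF gr' red', of T] same that by metis
  have bwd: "?f v = ?f w" if "v \<in> lists \<Omega>" "w \<in> lists \<Omega>" "?f' v = ?f' w" for v w
    using reduced_state_after_eq[OF gr red, of T'] same that by metis
  \<comment> \<open>An access word of \<open>q\<close> is chosen and run in \<open>T'\<close>. By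
    \<open>fwd\<close> the choice does not matter; \<open>bwd\<close> will give injectivity.\<close>
  define \<Phi> where "\<Phi> q = ?f' (SOME w. w \<in> lists \<Omega> \<and> ?f w = q)" for q
  have \<Phi>: "\<Phi> (?f w) = ?f' w" if "w \<in> lists \<Omega>" for w
  proof -
    have "(SOME v. v \<in> lists \<Omega> \<and> ?f v = ?f w) \<in> lists \<Omega> \<and>
        ?f (SOME v. v \<in> lists \<Omega> \<and> ?f v = ?f w) = ?f w"
      by (rule someI[of _ w]) (use that in simp)
    then show ?thesis using fwd that unfolding \<Phi>_def by blast
  qed
  have word: "\<exists>w\<in>lists \<Omega>. q = ?f w" if "q \<in> states T" for q
    using accessibleE[OF acc that] inp by metis
  have word': "\<exists>w\<in>lists \<Omega>. q = ?f' w" if "q \<in> states T'" for q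
    using accessibleE[OF acc' that] inp by metis
  show ?thesis
    unfolding isomorphic_def
  proof (intro exI[of _ \<Phi>] conjI ballI)
    show "bij_betw \<Phi> (states T) (states T')"
    proof (rule bij_betw_imageI)
      show "inj_on \<Phi> (states T)"
        by (rule inj_onI) (metis word \<Phi> bwd)
      show "\<Phi> ` states T = states T'"
      proof (intro equalityI subsetI)
        show "r \<in> states T'" if "r \<in> \<Phi> ` states T" for r
          using that word \<Phi> closed(2) by fastforce
        show "r \<in> \<Phi> ` states T" if "r \<in> states T'" for r
          using word'[OF that] \<Phi> closed(1) by (metis imageI)
      qed
    qed
    show "\<Phi> (trans T q u) = trans T' (\<Phi> q) u" if "q \<in> states T" "u \<in> inputs T" for q u
    proof -
      \<comment> \<open>Appending \<open>u\<close> to an access word of \<open>q\<close> gives an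
        access word of its successor.\<close>
      obtain w where w: "w \<in> lists \<Omega>" "q = ?f w" using word \<open>q \<in> states T\<close> by blast
      then show ?thesis using \<Phi>[of w] \<Phi>[of "w @ [u]"] \<open>u \<in> inputs T\<close> inp by simp
    qed
    show "lab T' (\<Phi> q) = lab T q" if "q \<in> states T" for q
      using word[OF that] \<Phi> same by metis
  qed
qed

theorem theorem5p8:
  fixes S :: "'s set" and E :: "('s \<times> 's) set" and \<Omega> :: "'u set"
    and T :: "('q, 'u, 's) transducer" and T' :: "('r, 'u, 's) transducer"
  assumes "finite S" and "E \<subseteq> S \<times> S" and "finite \<Omega>"
    and "graph_respecting S E \<Omega> T" and "graph_respecting S E \<Omega> T'"
    and "accessible T" and "accessible T'"
    and "fiber_linear T" and "fiber_linear T'"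
    and "lab T (init T) = lab T' (init T')"
    and "\<forall>i\<in>S. visibly_reachable T i \<and> nonself_departure T i"
    and "\<forall>i\<in>S. visibly_reachable T' i \<and> nonself_departure T' i"
    and "\<forall>w\<in>lists \<Omega>. emitted T w = emitted T' w"
  shows "isomorphic T T'"
proof (rule reduced_isomorphic[OF assms(4-7)])
  show "reduced T" using fiber_linear_reduced[OF assms(4,8)] assms(11) by blast
  show "reduced T'" using fiber_linear_reduced[OF assms(5,9)] assms(12) by blast
  show "lab T (state_after T (init T) w) = lab T' (state_after T' (init T') w)"
    if "w \<in> lists \<Omega>" for w
    \<comment> \<open>Equality of the initial labels settles the empty word, about which the emitted
      strings say nothing.\<close>
    using that assms(10,13) by (simp flip: last_emitted)
qed

end
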